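(* $\mathsf{id}_3\equiv\mathsf{PHP}^3_2\equiv\mathsf{PHP}^4_2>\mathsf{PHP}^5_2$. Moreover, for every integer $n>2$, $$\mathsf{id}_{\binom{n+1}{2}}\equiv\mathsf{PHP}^{n+1}_n>\mathsf{PHP}^{n+2}_n\ge\mathsf{PHP}^{2n}_n>\mathsf{PHP}^{2n+1}_n\ge\mathsf{PHP}^{n^2}_n>\mathsf{PHP}^{n^2+1}_n.$$
   Context: A number $N\ge1$ is identified with $\{0,\dots,N-1\}$. A (finite) problem $\mathsf{P}$ consists of a nonempty finite set of instances and, for each instance $x$, a nonempty finite set $\mathsf{P}(x)$ of solutions. For finite problems, $\mathsf{P}\le\mathsf{Q}$ if there exist a map $\Phi$ sending each $\mathsf{P}$-instance $x$ to a $\mathsf{Q}$-instance and a (partial) map $\Psi$ on $\mathsf{Q}$-solutions such that $\Psi(y)\in\mathsf{P}(x)$ whenever $y\in\mathsf{Q}(\Phi(x))$. $\mathsf{P}\equiv\mathsf{Q}$ means $\mathsf{P}\le\mathsf{Q}$ and $\mathsf{Q}\le\mathsf{P}$; $\mathsf{P}>\mathsf{Q}$ means $\mathsf{Q}\le\mathsf{P}$ and $\mathsf{P}\not\le\mathsf{Q}$; $\mathsf{P}\ge\mathsf{Q}$ means $\mathsf{Q}\le\mathsf{P}$. For $m>n\ge2$, $\mathsf{PHP}^m_n$ has as instances all functions $f:m\to n$, with solutions all unordered pairs $\{i,j\}$, $i\ne j$, $f(i)=f(j)$. For $k\ge1$, $\mathsf{id}_k$ has instances $j\in\{1,\dots,k\}$,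 each instance $j$ having unique solution $j$. *)

theory Defs
  imports "HOL-Library.FuncSet"
begin

record ('i, 's) problem =
  instances :: "'i set"
  solutions :: "'i \<Rightarrow> 's set"

definition finite_problem :: "('i, 's) problem \<Rightarrow> bool" where
  "finite_problem P \<longleftrightarrow>
     finite (instances P) \<and> instances P \<noteq> {} \<and>
     (\<forall>x\<in>instances P. finite (solutions P x) \<and> solutions P x \<noteq> {})"

text \<open>
  The backward map \<open>\<Psi>\<close> sees only the solution \<open>y\<close>, not the instance \<open>x\<close>; it has to be
  defined at least on the solutions of the instances in the range of \<open>\<Phi>\<close>.
\<close>

definition reducible :: "('i, 's) problem \<Rightarrow> ('j, 't) problem \<Rightarrow> bool"
    (infix "\<le>\<^sub>P" 50) where
  "P \<le>\<^sub>P Q \<longleftrightarrow>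
     (\<exists>(\<Phi> :: 'i \<Rightarrow> 'j) (\<Psi> :: 't \<rightharpoonup> 's).
        \<Phi> \<in> instances P \<rightarrow> instances Q \<and>
        (\<forall>x\<in>instances P. \<forall>y\<in>solutions Q (\<Phi> x).
           \<exists>z. \<Psi> y = Some z \<and> z \<in> solutions P x))"

abbreviation reducible_rev :: "('i, 's) problem \<Rightarrow> ('j, 't) problem \<Rightarrow> bool"
    (infix "\<ge>\<^sub>P" 50) where
  "P \<ge>\<^sub>P Q \<equiv> Q \<le>\<^sub>P P"

definition problem_equiv :: "('i, 's) problem \<Rightarrow> ('j, 't) problem \<Rightarrow> bool"
    (infix "\<equiv>\<^sub>P" 50) where
  "P \<equiv>\<^sub>P Q \<longleftrightarrow> P \<le>\<^sub>P Q \<and> Q \<le>\<^sub>P P"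

definition strictly_above :: "('i, 's) problem \<Rightarrow> ('j, 't) problem \<Rightarrow> bool"
    (infix ">\<^sub>P" 50) where
  "P >\<^sub>P Q \<longleftrightarrow> Q \<le>\<^sub>P P \<and> \<not> P \<le>\<^sub>P Q"

text \<open>
  \<open>PHP m n\<close> is the problem with \<open>m\<close> pigeons (upper index) and \<open>n\<close> holes (lower index).
  Functions are extensional, so that there are exactly \<open>n ^ m\<close> instances.
\<close>

definition PHP :: "nat \<Rightarrow> nat \<Rightarrow> (nat \<Rightarrow> nat, nat set) problem" where
  "PHP m n =
     \<lparr>instances = {..<m} \<rightarrow>\<^sub>E {..<n},
      solutions = (\<lambda>f. {{i, j} | i j. i < m \<and> j < m \<and> i \<noteq> j \<and> f i = f j})\<rparr>"

definition id_problem :: "nat \<Rightarrow> (nat, nat) problem" where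
  "id_problem k = \<lparr>instances = {1..k}, solutions = (\<lambda>j. {j})\<rparr>"

lemma finite_problem_id_problem:
  assumes "k \<ge> 1"
  shows "finite_problem (id_problem k)"
  using assms by (auto simp: finite_problem_def id_problem_def)

lemma finite_problem_PHP:
  assumes "m > n" and "n \<ge> 2"
  shows "finite_problem (PHP m n)"
proof -
  have "finite {{i, j} | i j. i < m \<and> j < m \<and> i \<noteq> j \<and> f i = f j}" for f :: "nat \<Rightarrow> nat"
    by (rule finite_subset[of _ "Pow {..<m}"]) auto
  moreover have "\<exists>i j. i < m \<and> j < m \<and> i \<noteq> j \<and> f i = f j"
    if f: "f \<in> {..<m} \<rightarrow>\<^sub>E {..<n}" for f :: "nat \<Rightarrow> nat"
  proof -
    have "card (f ` {..<m}) \<le> card {..<n}"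
      using f by (intro card_mono) auto
    then have "\<not> inj_on f {..<m}"
      using assms by (auto dest: card_image)
    then show ?thesis
      by (auto simp: inj_on_def)
  qed
  ultimately show ?thesis
    using assms
    by (auto simp: finite_problem_def PHP_def finite_PiE PiE_eq_empty_iff lessThan_empty_iff) blast
qed

end

theory Submission
  imports Defs "HOL-Combinatorics.Permutations"
begin

text \<open>
  All strict separations come from one averaging argument. Suppose \<open>\<Phi>, \<Psi>\<close> witness
  \<open>PHP m n \<le>\<^sub>P PHP (m + 1) n\<close>. Apply them to \<open>g \<circ> p\<close>, where \<open>g\<close> is a balanced map with
  the least possible number \<open>s\<close> of collisions and \<open>p\<close> is a uniformly random permutation
  of the pigeons. A fixed pair is then a collision with probability \<open>s / (m choose 2)\<close>, so on average
  \<open>\<Psi>\<close> sends at most \<open>s * ((m + 1) choose 2) / (m choose 2)\<close> pairs to collisions of \<open>g \<circ> p\<close>;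
  on the other hand all collisions of \<open>\<Phi> (g \<circ> p)\<close> are sent there. So the minimal collision
  density cannot grow from \<open>m\<close> to \<open>m + 1\<close> pigeons. By convexity it does grow, unless \<open>n\<close>
  divides \<open>m + 1\<close>.
\<close>

section \<open>Reducibility\<close>

lemma reducibleI:
  assumes "\<And>x. x \<in> instances P \<Longrightarrow> \<Phi> x \<in> instances Q"
    and "\<And>x y. x \<in> instances P \<Longrightarrow> y \<in> solutions Q (\<Phi> x) \<Longrightarrow> \<psi> y \<in> solutions P x"
  shows "P \<le>\<^sub>P Q"
  unfolding reducible_def
  by (rule exI[of _ \<Phi>], rule exI[of _ "\<lambda>y. Some (\<psi> y)"]) (use assms in auto)

text \<open>Partiality of the backward map can be ignored from here on: \<open>the\<close> yields an
  arbitrary value where \<open>\<Psi>\<close> is undefined, but no solution of an instance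
  \<open>\<Phi> x\<close> lies there.\<close>

lemma reducibleE:
  assumes "P \<le>\<^sub>P Q"
  obtains \<Phi> \<psi> where "\<And>x. x \<in> instances P \<Longrightarrow> \<Phi> x \<in> instances Q"
    and "\<And>x y. x \<in> instances P \<Longrightarrow> y \<in> solutions Q (\<Phi> x) \<Longrightarrow> \<psi> y \<in> solutions P x"
proof -
  from assms obtain \<Phi> \<Psi> where \<Phi>: "\<Phi> \<in> instances P \<rightarrow> instances Q"
    and \<Psi>: "\<And>x y. x \<in> instances P \<Longrightarrow> y \<in> solutions Q (\<Phi> x) \<Longrightarrow>
      \<exists>z. \<Psi> y = Some z \<and> z \<in> solutions P x"
    unfolding reducible_def by blast
  show thesis
  proof (rule that[of \<Phi> "\<lambda>y. the (\<Psi> y)"])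
    show "\<Phi> x \<in> instances Q" if "x \<in> instances P" for x
      using \<Phi> that by blast
    show "the (\<Psi> y) \<in> solutions P x"
      if "x \<in> instances P" "y \<in> solutions Q (\<Phi> x)" for x y
      using \<Psi>[OF that] by auto
  qed
qed

lemma reducible_trans:
  assumes "P \<le>\<^sub>P Q" "Q \<le>\<^sub>P R"
  shows "P \<le>\<^sub>P R"
proof -
  obtain \<Phi> \<psi> where 1: "\<And>x. x \<in> instances P \<Longrightarrow> \<Phi> x \<in> instances Q"
    "\<And>x y. x \<in> instances P \<Longrightarrow> y \<in> solutions Q (\<Phi> x) \<Longrightarrow> \<psi> y \<in> solutions P x"
    using assms(1) by (rule reducibleE) blast
  obtain \<Phi>' \<psi>' where 2: "\<And>x. x \<in> instances Q \<Longrightarrow> \<Phi>' x \<in> instances R"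
    "\<And>x y. x \<in> instances Q \<Longrightarrow> y \<in> solutions R (\<Phi>' x) \<Longrightarrow> \<psi>' y \<in> solutions Q x"
    using assms(2) by (rule reducibleE) blast
  show ?thesis
    by (rule reducibleI[of _ "\<lambda>x. \<Phi>' (\<Phi> x)" _ "\<lambda>y. \<psi> (\<psi>' y)"]) (simp_all add: 1 2)
qed

text \<open>Pairwise disjoint solution sets make the instance recoverable from any one of its
  solutions, and this is all that the backward map has to do.\<close>

lemma id_problem_reducibleI:
  assumes "\<And>j. j \<in> {1..k} \<Longrightarrow> \<Phi> j \<in> instances Q"
    and disj: "\<And>i j y. i \<in> {1..k} \<Longrightarrow> j \<in> {1..k} \<Longrightarrow>
      y \<in> solutions Q (\<Phi> i) \<Longrightarrow> y \<in> solutions Q (\<Phi> j) \<Longrightarrow> i = j"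
  shows "id_problem k \<le>\<^sub>P Q"
proof (rule reducibleI[of _ \<Phi> _ "\<lambda>y. THE j. j \<in> {1..k} \<and> y \<in> solutions Q (\<Phi> j)"])
  show "\<Phi> j \<in> instances Q" if "j \<in> instances (id_problem k)" for j
    using assms(1) that by (simp add: id_problem_def)
  show "(THE j. j \<in> {1..k} \<and> y \<in> solutions Q (\<Phi> j)) \<in> solutions (id_problem k) i"
    if "i \<in> instances (id_problem k)" "y \<in> solutions Q (\<Phi> i)" for i y
  proof -
    have i: "i \<in> {1..k}"
      using that(1) by (simp add: id_problem_def)
    then have "(THE j. j \<in> {1..k} \<and> y \<in> solutions Q (\<Phi> j)) = i"
      by (intro the_equality) (use that(2) disj in blast)+
    then show ?thesis
      by (simp add: id_problem_def)
  qed
qed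

lemma instances_PHP: "instances (PHP m n) = {..<m} \<rightarrow>\<^sub>E {..<n}"
  by (simp add: PHP_def)

lemma mem_solutions_PHP:
  "e \<in> solutions (PHP m n) f \<longleftrightarrow> (\<exists>i j. e = {i, j} \<and> i < m \<and> j < m \<and> i \<noteq> j \<and> f i = f j)"
  by (auto simp: PHP_def)

lemma pair_mem_solutions_PHP:
  "{i, j} \<in> solutions (PHP m n) f \<longleftrightarrow> i < m \<and> j < m \<and> i \<noteq> j \<and> f i = f j"
  by (auto simp: mem_solutions_PHP doubleton_eq_iff)

lemma PHP_antimono:
  assumes "m \<le> m'"
  shows "PHP m' n \<le>\<^sub>P PHP m n"
proof (rule reducibleI[of _ "\<lambda>f. restrict f {..<m}" _ "\<lambda>e. e"])
  show "restrict f {..<m} \<in> instances (PHP m n)" if "f \<in> instances (PHP m' n)" for f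
    using that assms by (auto simp: instances_PHP PiE_iff)
  show "e \<in> solutions (PHP m' n) f" if "e \<in> solutions (PHP m n) (restrict f {..<m})" for f e
    using that assms by (fastforce simp: mem_solutions_PHP)
qed

section \<open>Equivalences with identity problems\<close>

text \<open>The forward map may solve the instance itself: it picks one colliding pair and passes on
  its number in an enumeration of all 2-subsets, which the backward map decodes.\<close>

lemma PHP_le_id_problem:
  assumes "n < m"
  shows "PHP m n \<le>\<^sub>P id_problem (m choose 2)"
proof -
  define E where "E = {e. e \<subseteq> {..<m} \<and> card e = 2}"
  have "finite E" "card E = m choose 2"
    by (auto simp: E_def n_subsets)
  then obtain h where h: "bij_betw h E {1..m choose 2}"
    by (metis card_atLeastAtMost diff_Suc_1 finite_atLeastAtMost finite_same_card_bij)
  define \<phi> where "\<phi> f = (SOME e. e \<in> solutions (PHP m n) f)" for f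
  have \<phi>: "\<phi> f \<in> solutions (PHP m n) f" if "f \<in> instances (PHP m n)" for f
  proof -
    have "card (f ` {..<m}) \<le> card {..<n}"
      using that by (intro card_mono) (auto simp: instances_PHP)
    then have "\<not> inj_on f {..<m}"
      using assms by (auto dest: card_image)
    then have "\<exists>e. e \<in> solutions (PHP m n) f"
      by (auto simp: inj_on_def mem_solutions_PHP)
    then show ?thesis
      unfolding \<phi>_def by (rule someI_ex)
  qed
  then have \<phi>_E: "\<phi> f \<in> E" if "f \<in> instances (PHP m n)" for f
    using that by (fastforce simp: E_def mem_solutions_PHP)
  show ?thesis
  proof (rule reducibleI[of _ "\<lambda>f. h (\<phi> f)" _ "inv_into E h"])
    show "h (\<phi> f) \<in> instances (id_problem (m choose 2))" if "f \<in> instances (PHP m n)" for f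
      using bij_betwE[OF h] \<phi>_E[OF that] by (simp add: id_problem_def)
    show "inv_into E h y \<in> solutions (PHP m n) f"
      if "f \<in> instances (PHP m n)" "y \<in> solutions (id_problem (m choose 2)) (h (\<phi> f))" for f y
      using that \<phi>[OF that(1)] bij_betw_inv_into_left[OF h \<phi>_E[OF that(1)]]
      by (simp add: id_problem_def)
  qed
qed

text \<open>The \<open>n\<close> pigeons other than \<open>a\<close> fill the holes bijectively, and
  \<open>a\<close> then joins \<open>b\<close>.\<close>

lemma PHP_instance_with_unique_collision:
  assumes "a < Suc n" "b < Suc n" "a \<noteq> b"
  shows "\<exists>f \<in> instances (PHP (Suc n) n). solutions (PHP (Suc n) n) f = {{a, b}}"
proof -
  obtain h where h: "bij_betw h ({..<Suc n} - {a}) {..<n}"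
    using finite_same_card_bij[of "{..<Suc n} - {a}" "{..<n}"] assms by auto
  define f where "f = restrict (h(a := h b)) {..<Suc n}"
  have "f \<in> instances (PHP (Suc n) n)"
    using bij_betwE[OF h] assms by (auto simp: f_def instances_PHP)
  moreover have "{i, j} = {a, b}"
    if "i < Suc n" "j < Suc n" "i \<noteq> j" "f i = f j" for i j
  proof -
    have inj: "x = y" if "h x = h y" "x < Suc n" "y < Suc n" "x \<noteq> a" "y \<noteq> a" for x y
      using that inj_onD[OF bij_betw_imp_inj_on[OF h], of x y] by simp
    consider "i = a" | "j = a" | "i \<noteq> a" "j \<noteq> a"
      by blast
    then show ?thesis
    proof cases
      case 1
      then have "h b = h j"
        using that by (simp add: f_def)
      then have "b = j"
        using inj[of b j] that assms 1 by blast
      with 1 show ?thesis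
        by simp
    next
      case 2
      then have "h b = h i"
        using that by (simp add: f_def)
      then have "b = i"
        using inj[of b i] that assms 2 by blast
      with 2 show ?thesis
        by blast
    next
      case 3
      then show ?thesis
        using inj[of i j] that by (simp add: f_def)
    qed
  qed
  moreover have "f a = f b"
    using assms by (simp add: f_def)
  ultimately have "f \<in> instances (PHP (Suc n) n) \<and> solutions (PHP (Suc n) n) f = {{a, b}}"
    using assms unfolding set_eq_iff mem_solutions_PHP by blast
  then show ?thesis
    by blast
qed

text \<open>Every 2-subset is the sole solution of some instance, so the 2-subsets give instances
  with pairwise disjoint solution sets.\<close>

lemma id_problem_equiv_PHP_Suc: "id_problem (Suc n choose 2) \<equiv>\<^sub>P PHP (Suc n) n"
proof -
  define E where "E = {e. e \<subseteq> {..<Suc n} \<and> card e = 2}"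
  have "finite E" "card E = Suc n choose 2"
    by (auto simp: E_def n_subsets)
  then obtain h where h: "bij_betw h {1..Suc n choose 2} E"
    by (metis card_atLeastAtMost diff_Suc_1 finite_atLeastAtMost finite_same_card_bij)
  have "\<exists>f. f \<in> instances (PHP (Suc n) n) \<and> solutions (PHP (Suc n) n) f = {e}" if "e \<in> E" for e
    using that PHP_instance_with_unique_collision[of _ n] by (fastforce simp: E_def card_2_iff)
  then obtain F where F: "\<And>e. e \<in> E \<Longrightarrow> F e \<in> instances (PHP (Suc n) n)"
    "\<And>e. e \<in> E \<Longrightarrow> solutions (PHP (Suc n) n) (F e) = {e}"
    by metis
  have "id_problem (Suc n choose 2) \<le>\<^sub>P PHP (Suc n) n"
  proof (rule id_problem_reducibleI[of _ "\<lambda>j. F (h j)"])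
    show "F (h j) \<in> instances (PHP (Suc n) n)" if "j \<in> {1..Suc n choose 2}" for j
      using F(1) bij_betwE[OF h] that by blast
    show "i = j" if "i \<in> {1..Suc n choose 2}" "j \<in> {1..Suc n choose 2}"
      "y \<in> solutions (PHP (Suc n) n) (F (h i))" "y \<in> solutions (PHP (Suc n) n) (F (h j))" for i j y
      using that F(2) bij_betwE[OF h] inj_onD[OF bij_betw_imp_inj_on[OF h], of i j] by auto
  qed
  then show ?thesis
    by (simp add: problem_equiv_def PHP_le_id_problem)
qed

text \<open>The three instances are the partitions of four pigeons into two pairs.\<close>

lemma id_problem_3_le_PHP_4_2: "id_problem 3 \<le>\<^sub>P PHP 4 2"
proof (rule id_problem_reducibleI
    [of _ "\<lambda>j. restrict (\<lambda>i. if i = 0 \<or> i = j then 0 else 1) {..<4}"])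
  fix i j :: nat and y
  assume ij: "i \<in> {1..3}" "j \<in> {1..3}"
    and y: "y \<in> solutions (PHP 4 2) (restrict (\<lambda>x. if x = 0 \<or> x = i then 0 else 1) {..<4})"
      "y \<in> solutions (PHP 4 2) (restrict (\<lambda>x. if x = 0 \<or> x = j then 0 else 1) {..<4})"
  from y(1) obtain a b where y_eq: "y = {a, b}"
    by (auto simp: mem_solutions_PHP)
  have eq_iff: "(if P then 0 else 1) = (if Q then 0 else 1 :: nat) \<longleftrightarrow> (P \<longleftrightarrow> Q)" for P Q
    by simp
  have ab: "a < 4" "b < 4" "a \<noteq> b"
    using y(1) unfolding y_eq pair_mem_solutions_PHP by simp_all
  have "(a = 0 \<or> a = i) = (b = 0 \<or> b = i)" "(a = 0 \<or> a = j) = (b = 0 \<or> b = j)"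
    using y ab unfolding y_eq pair_mem_solutions_PHP by (simp_all only: restrict_apply' lessThan_iff eq_iff)
  moreover from ab have "a = 0 \<or> a = 1 \<or> a = 2 \<or> a = 3" "b = 0 \<or> b = 1 \<or> b = 2 \<or> b = 3"
    by linarith+
  moreover have "i = 1 \<or> i = 2 \<or> i = 3" "j = 1 \<or> j = 2 \<or> j = 3"
    using ij by auto
  ultimately show "i = j"
    using ab by (elim disjE) simp_all
qed (auto simp: instances_PHP)

section \<open>The averaging argument\<close>

text \<open>Ordered pairs replace unordered ones. Each unordered pair is counted twice, a factor
  that cancels when densities are compared, so no binomial coefficients or halves appear.\<close>

definition off_diagonal :: "nat \<Rightarrow> (nat \<times> nat) set" where
  "off_diagonal m = {(i, j). i < m \<and> j < m \<and> i \<noteq> j}"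

definition collisions :: "nat \<Rightarrow> (nat \<Rightarrow> nat) \<Rightarrow> (nat \<times> nat) set" where
  "collisions m f = {(i, j) \<in> off_diagonal m. f i = f j}"

lemma finite_off_diagonal [simp]: "finite (off_diagonal m)"
  by (rule finite_subset[of _ "{..<m} \<times> {..<m}"]) (auto simp: off_diagonal_def)

lemma finite_collisions [simp]: "finite (collisions m f)"
  by (rule finite_subset[OF _ finite_off_diagonal]) (auto simp: collisions_def)

lemma card_off_diagonal: "card (off_diagonal m) = m * (m - 1)"
proof -
  have "off_diagonal m = Sigma {..<m} (\<lambda>i. {..<m} - {i})"
    by (auto simp: off_diagonal_def)
  then show ?thesis
    by simp
qed

lemma pair_mem_solutions_PHP_iff_collision:
  "{i, j} \<in> solutions (PHP m n) f \<longleftrightarrow> (i, j) \<in> collisions m f"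
  by (auto simp: pair_mem_solutions_PHP collisions_def off_diagonal_def)

lemma card_collisions_permutes:
  assumes p: "p permutes {..<m}"
  shows "card (collisions m (g \<circ> p)) = card (collisions m g)"
proof (rule bij_betw_same_card)
  have lt: "p x < m \<longleftrightarrow> x < m" for x
    using permutes_in_image[OF p, of x] by simp
  have inj: "p x = p y \<longleftrightarrow> x = y" for x y
    using permutes_inj[OF p] by (auto dest: injD)
  have p_inv: "p (inv p x) = x" for x
    using permutes_inverses(1)[OF p] .
  show "bij_betw (map_prod p p) (collisions m (g \<circ> p)) (collisions m g)"
  proof (rule bij_betw_imageI)
    show "inj_on (map_prod p p) (collisions m (g \<circ> p))"
      by (auto simp: inj_on_def inj)
    show "map_prod p p ` collisions m (g \<circ> p) = collisions m g"
    proof (intro subset_antisym subsetI)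
      fix z assume "z \<in> collisions m g"
      then obtain i j where z: "z = (i, j)" "(i, j) \<in> collisions m g"
        by (cases z) auto
      have "inv p i < m \<longleftrightarrow> i < m" for i
        using lt[of "inv p i"] by (simp add: p_inv)
      moreover have "inv p i = inv p j \<Longrightarrow> i = j"
        by (metis p_inv)
      ultimately have "(inv p i, inv p j) \<in> collisions m (g \<circ> p)"
        using z(2) by (auto simp: collisions_def off_diagonal_def p_inv)
      then show "z \<in> map_prod p p ` collisions m (g \<circ> p)"
        unfolding z(1) by (rule rev_image_eqI) (simp add: p_inv)
    qed (auto simp: collisions_def off_diagonal_def lt inj)
  qed
qed

text \<open>Double transitivity of the symmetric group: one transposition takes \<open>i\<close> to
  \<open>a\<close>, and a second one corrects the image of \<open>j\<close> without moving
  \<open>a\<close>.\<close>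

lemma exists_permutes_pair:
  fixes m :: nat
  assumes "(i, j) \<in> off_diagonal m" "(a, b) \<in> off_diagonal m"
  shows "\<exists>q. q permutes {..<m} \<and> q i = a \<and> q j = b"
proof -
  define t where "t = transpose i a"
  define u where "u = transpose (t j) b"
  have t: "t permutes {..<m}"
    unfolding t_def using assms by (intro permutes_swap_id) (auto simp: off_diagonal_def)
  have ti: "t i = a"
    by (simp add: t_def)
  have tj: "t j \<noteq> a"
    using injD[OF permutes_inj[OF t], of i j] assms ti by (auto simp: off_diagonal_def)
  have "t j < m"
    using permutes_in_image[OF t, of j] assms by (auto simp: off_diagonal_def)
  then have "u permutes {..<m}"
    unfolding u_def using assms by (intro permutes_swap_id) (auto simp: off_diagonal_def)
  with t have "u \<circ> t permutes {..<m}"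
    by (rule permutes_compose)
  moreover have "(u \<circ> t) i = a"
    using assms tj by (auto simp: u_def ti off_diagonal_def)
  moreover have "(u \<circ> t) j = b"
    by (simp add: u_def)
  ultimately show ?thesis
    by blast
qed

text \<open>The probability statement with denominators cleared. By double transitivity the count is
  the same for every pair, so it equals its average over all pairs, which is found by double
  counting.\<close>

lemma card_permutes_collision:
  assumes "(i, j) \<in> off_diagonal m"
  shows "m * (m - 1) * card {p. p permutes {..<m} \<and> (i, j) \<in> collisions m (g \<circ> p)} =
    fact m * card (collisions m g)"
proof -
  define S where "S = {p. p permutes {..<m}}"
  define N where "N z = card {p \<in> S. z \<in> collisions m (g \<circ> p)}" for z
  have S: "finite S" "card S = fact m"
    by (simp_all add: S_def finite_permutations card_permutations)
  have N_le: "N (i, j) \<le> N (a, b)"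
    if ij: "(i, j) \<in> off_diagonal m" and ab: "(a, b) \<in> off_diagonal m" for i j a b
  proof -
    obtain q where q: "q permutes {..<m}" "q a = i" "q b = j"
      using exists_permutes_pair[OF ab ij] by blast
    show ?thesis
      \<comment> \<open>Composing with \<open>q\<close> on the right injects the permutations that
        make \<open>(i, j)\<close> collide into those that make \<open>(a, b)\<close> collide.
        Exchanging the two pairs gives the reverse inequality.\<close>
      unfolding N_def
    proof (rule card_inj_on_le[of "\<lambda>p. p \<circ> q"])
      show "inj_on (\<lambda>p. p \<circ> q) {p \<in> S. (i, j) \<in> collisions m (g \<circ> p)}"
        using permutes_surj[OF q(1)] by (intro inj_onI) (simp add: surj_fun_eq[of q UNIV] fun_eq_iff surj_def, metis)
      show "(\<lambda>p. p \<circ> q) ` {p \<in> S. (i, j) \<in> collisions m (g \<circ> p)}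
        \<subseteq> {p \<in> S. (a, b) \<in> collisions m (g \<circ> p)}"
        using ij ab q by (auto simp: S_def collisions_def permutes_compose)
      show "finite {p \<in> S. (a, b) \<in> collisions m (g \<circ> p)}"
        using S by simp
    qed
  qed
  then have N_eq: "N z = N (i, j)" if "z \<in> off_diagonal m" for z
    using that assms by (cases z) (auto intro!: antisym)
  have "m * (m - 1) * N (i, j) = (\<Sum>z\<in>off_diagonal m. N z)"
    using N_eq by (simp add: card_off_diagonal)
  also have "\<dots> = (\<Sum>p\<in>S. card {z \<in> off_diagonal m. z \<in> collisions m (g \<circ> p)})"
    unfolding N_def by (rule sum_multicount_gen[symmetric]) (use S in auto)
  also have "\<dots> = (\<Sum>p\<in>S. card (collisions m g))"
  proof (rule sum.cong)
    fix p assume "p \<in> S"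
    have "{z \<in> off_diagonal m. z \<in> collisions m (g \<circ> p)} = collisions m (g \<circ> p)"
      by (auto simp: collisions_def)
    then show "card {z \<in> off_diagonal m. z \<in> collisions m (g \<circ> p)} = card (collisions m g)"
      using card_collisions_permutes \<open>p \<in> S\<close> by (simp add: S_def)
  qed simp
  also have "\<dots> = fact m * card (collisions m g)"
    by (simp add: S)
  finally show ?thesis
    by (simp add: N_def S_def)
qed

text \<open>The comparison of collision densities, cross-multiplied. It comes from counting in two
  ways the permutations \<open>p\<close> and pairs \<open>z\<close> related by
  \<open>R\<close>.\<close>

lemma PHP_reducible_imp_collision_density_le:
  assumes red: "PHP m n \<le>\<^sub>P PHP m' n"
    and g: "g \<in> {..<m} \<rightarrow> {..<n}"
    and lower: "\<And>h. h \<in> {..<m'} \<rightarrow> {..<n} \<Longrightarrow> t \<le> card (collisions m' h)"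
  shows "t * (m * (m - 1)) \<le> card (collisions m g) * (m' * (m' - 1))"
proof -
  obtain \<Phi> \<psi> where \<Phi>: "\<And>f. f \<in> instances (PHP m n) \<Longrightarrow> \<Phi> f \<in> instances (PHP m' n)"
    and \<psi>: "\<And>f e. f \<in> instances (PHP m n) \<Longrightarrow> e \<in> solutions (PHP m' n) (\<Phi> f)
      \<Longrightarrow> \<psi> e \<in> solutions (PHP m n) f"
    using red by (rule reducibleE) blast
  define S where "S = {p. p permutes {..<m}}"
  define F where "F p = restrict (g \<circ> p) {..<m}" for p
  \<comment> \<open>\<open>R\<close> does not ask whether \<open>z\<close> is a collision of
    \<open>\<Phi> (F p)\<close>. For fixed \<open>z\<close> the number of related \<open>p\<close>
    thus depends only on the single value of \<open>\<psi>\<close> at \<open>z\<close>.\<close>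
  define R where "R p z \<longleftrightarrow> \<psi> {fst z, snd z} \<in> solutions (PHP m n) (F p)" for p z
  have S: "finite S" "card S = fact m"
    by (simp_all add: S_def finite_permutations card_permutations)
  have F: "F p \<in> instances (PHP m n)" if "p \<in> S" for p
    using g permutes_in_image[of p "{..<m}"] that
    by (auto simp: F_def S_def instances_PHP Pi_iff)
  have coll_F: "collisions m (F p) = collisions m (g \<circ> p)" for p
    by (auto simp: F_def collisions_def off_diagonal_def)
  have "t \<le> card {z \<in> off_diagonal m'. R p z}" if "p \<in> S" for p
  proof -
    have "t \<le> card (collisions m' (\<Phi> (F p)))"
      using \<Phi>[OF F[OF that]] by (intro lower) (auto simp: instances_PHP)
    also have "\<dots> \<le> card {z \<in> off_diagonal m'. R p z}"
    proof (rule card_mono)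
      show "collisions m' (\<Phi> (F p)) \<subseteq> {z \<in> off_diagonal m'. R p z}"
        using \<psi>[OF F[OF that]]
        by (auto simp: R_def pair_mem_solutions_PHP_iff_collision) (auto simp: collisions_def)
    qed simp
    finally show ?thesis .
  qed
  then have "fact m * t \<le> (\<Sum>p\<in>S. card {z \<in> off_diagonal m'. R p z})"
    using sum_bounded_below[of S t "\<lambda>p. card {z \<in> off_diagonal m'. R p z}"] S by simp
  also have "\<dots> = (\<Sum>z\<in>off_diagonal m'. card {p \<in> S. R p z})"
    by (rule sum_multicount_gen) (use S in auto)
  finally have count: "fact m * t \<le> (\<Sum>z\<in>off_diagonal m'. card {p \<in> S. R p z})" .
  \<comment> \<open>Either \<open>\<psi>\<close> sends \<open>z\<close> to a genuine pair, whose
    collision count is known exactly, or its value solves no instance at all.\<close>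
  have R_card: "m * (m - 1) * card {p \<in> S. R p z} \<le> fact m * card (collisions m g)" for z
  proof (cases "\<exists>i j. \<psi> {fst z, snd z} = {i, j} \<and> (i, j) \<in> off_diagonal m")
    case True
    then obtain i j where ij: "\<psi> {fst z, snd z} = {i, j}" "(i, j) \<in> off_diagonal m"
      by blast
    have "{p \<in> S. R p z} = {p. p permutes {..<m} \<and> (i, j) \<in> collisions m (g \<circ> p)}"
      by (simp add: S_def R_def ij(1) pair_mem_solutions_PHP_iff_collision coll_F)
    then show ?thesis
      using card_permutes_collision[OF ij(2), of g] by simp
  next
    case False
    then have "{p \<in> S. R p z} = {}"
      by (auto simp: R_def mem_solutions_PHP off_diagonal_def)
    then show ?thesis
      by (simp only: card.empty mult_0_right le0)
  qed
  have "fact m * (t * (m * (m - 1))) = m * (m - 1) * (fact m * t)"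
    by (simp add: mult_ac)
  also have "\<dots> \<le> m * (m - 1) * (\<Sum>z\<in>off_diagonal m'. card {p \<in> S. R p z})"
    using count by (rule mult_left_mono) simp
  also have "\<dots> = (\<Sum>z\<in>off_diagonal m'. m * (m - 1) * card {p \<in> S. R p z})"
    by (rule sum_distrib_left)
  also have "\<dots> \<le> (\<Sum>z\<in>off_diagonal m'. fact m * card (collisions m g))"
    by (rule sum_mono) (rule R_card)
  also have "\<dots> = fact m * (card (collisions m g) * (m' * (m' - 1)))"
    by (simp add: card_off_diagonal mult_ac)
  finally show ?thesis
    by (metis fact_gt_zero nat_mult_le_cancel1)
qed

section \<open>The minimal number of collisions\<close>

text \<open>A pigeon collides with all others in its fibre; grouping pigeons by hole then gives one
  term per fibre. Integers avoid truncated subtraction for empty fibres.\<close>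

lemma card_collisions_eq_sum_fibres:
  assumes "f \<in> {..<m} \<rightarrow> {..<n}"
  shows "int (card (collisions m f)) =
    (\<Sum>c<n. int (card {i. i < m \<and> f i = c}) * (int (card {i. i < m \<and> f i = c}) - 1))"
proof -
  let ?A = "\<lambda>c. {i. i < m \<and> f i = c}"
  have "card (collisions m f) = card (Sigma {..<m} (\<lambda>i. ?A (f i) - {i}))"
    by (rule arg_cong[of _ _ card]) (auto simp: collisions_def off_diagonal_def)
  also have "\<dots> = (\<Sum>i<m. card (?A (f i)) - 1)"
    by simp
  also have "int \<dots> = (\<Sum>i<m. int (card (?A (f i))) - 1)"
    unfolding of_nat_sum
  proof (rule sum.cong)
    fix i assume "i \<in> {..<m}"
    then have "card (?A (f i)) > 0"
      by (auto simp: card_gt_0_iff)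
    then show "int (card (?A (f i)) - 1) = int (card (?A (f i))) - 1"
      by simp
  qed simp
  also have "\<dots> = (\<Sum>c<n. \<Sum>i\<in>{i \<in> {..<m}. f i = c}. int (card (?A (f i))) - 1)"
    by (rule sum.group[symmetric]) (use assms in auto)
  also have "\<dots> = (\<Sum>c<n. int (card (?A c)) * (int (card (?A c)) - 1))"
    by (rule sum.cong) auto
  finally show ?thesis .
qed

lemma sum_card_fibres:
  fixes f :: "nat \<Rightarrow> nat"
  assumes "f \<in> {..<m} \<rightarrow> {..<n}"
  shows "(\<Sum>c<n. int (card {i. i < m \<and> f i = c})) = int m"
proof -
  have "(\<Sum>c<n. \<Sum>i\<in>{i \<in> {..<m}. f i = c}. 1) = (\<Sum>i<m. 1::int)"
    by (rule sum.group) (use assms in auto)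
  then show ?thesis
    by simp
qed

text \<open>
  The function \<open>a \<mapsto> a * (a - 1)\<close> lies above the line through its points at \<open>q\<close> and \<open>q + 1\<close>,
  because \<open>(a - q) * (a - q - 1) \<ge> 0\<close> for all integers \<open>a\<close>.
\<close>

lemma card_collisions_excess:
  fixes q :: int
  assumes "f \<in> {..<m} \<rightarrow> {..<n}"
  shows "int (card (collisions m f)) = 2 * q * int m - int n * (q * (q + 1)) +
    (\<Sum>c<n. (int (card {i. i < m \<and> f i = c}) - q) * (int (card {i. i < m \<and> f i = c}) - q - 1))"
proof -
  let ?a = "\<lambda>c. int (card {i. i < m \<and> f i = c})"
  have "int (card (collisions m f)) =
    (\<Sum>c<n. 2 * q * ?a c + - (q * (q + 1)) + (?a c - q) * (?a c - q - 1))"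
    unfolding card_collisions_eq_sum_fibres[OF assms]
    by (rule sum.cong) (simp_all add: algebra_simps)
  also have "\<dots> = 2 * q * (\<Sum>c<n. ?a c) + - (int n * (q * (q + 1))) +
    (\<Sum>c<n. (?a c - q) * (?a c - q - 1))"
    by (simp add: sum.distrib sum_subtractf sum_distrib_left)
  finally show ?thesis
    by (simp add: sum_card_fibres[OF assms])
qed

text \<open>The excess is a sum of products of two consecutive integers, none of which is
  negative.\<close>

lemma card_collisions_ge:
  fixes q :: int
  assumes "f \<in> {..<m} \<rightarrow> {..<n}"
  shows "2 * q * int m - int n * (q * (q + 1)) \<le> int (card (collisions m f))"
proof -
  have "0 \<le> (a - q) * (a - q - 1)" for a
    by (cases "a \<le> q") (auto intro: mult_nonpos_nonpos mult_nonneg_nonneg)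
  then show ?thesis
    unfolding card_collisions_excess[OF assms, of q] by (simp add: sum_nonneg)
qed

lemma card_mod_fibre:
  fixes c n q :: nat
  assumes "c < n"
  shows "card {i. i < q * n \<and> i mod n = c} = q"
proof -
  have "{i. i < q * n \<and> i mod n = c} = (\<lambda>k. k * n + c) ` {..<q}"
  proof (intro subset_antisym subsetI)
    fix i assume i: "i \<in> {i. i < q * n \<and> i mod n = c}"
    then have "i div n < q"
      using assms by (simp add: less_mult_imp_div_less)
    moreover have "i = i div n * n + c"
      using i by (metis (mono_tags) div_mult_mod_eq mem_Collect_eq)
    ultimately show "i \<in> (\<lambda>k. k * n + c) ` {..<q}"
      by blast
  next
    fix i assume "i \<in> (\<lambda>k. k * n + c) ` {..<q}"
    then obtain k where k: "k < q" "i = k * n + c"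
      by auto
    then have "Suc k * n \<le> q * n"
      by (intro mult_le_mono1) simp
    then have "i < q * n"
      using k assms by simp
    then show "i \<in> {i. i < q * n \<and> i mod n = c}"
      using k assms by simp
  qed
  moreover have "inj_on (\<lambda>k. k * n + c) {..<q}"
    using assms by (auto simp: inj_on_def)
  ultimately show ?thesis
    by (simp add: card_image)
qed

text \<open>The residue map attains the bound of \<open>card_collisions_ge\<close>: all its fibres
  have size \<open>q\<close> or \<open>q + 1\<close>, which makes every excess term vanish.\<close>

lemma card_collisions_mod:
  fixes m n q :: nat
  assumes "n > 0" "q * n \<le> m" "m \<le> Suc q * n"
  shows "int (card (collisions m (\<lambda>i. i mod n))) =
    2 * int q * int m - int n * (int q * (int q + 1))"
proof -
  have "(int (card {i. i < m \<and> i mod n = c}) - int q) *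
      (int (card {i. i < m \<and> i mod n = c}) - int q - 1) = 0"
    if "c < n" for c
  proof -
    \<comment> \<open>Fibre sizes are squeezed between those for \<open>q * n\<close> and
      \<open>Suc q * n\<close> pigeons, where they are exactly \<open>q\<close> and
      \<open>Suc q\<close>.\<close>
    have "card {i. i < q * n \<and> i mod n = c} \<le> card {i. i < m \<and> i mod n = c}"
      using assms by (intro card_mono) auto
    moreover have "card {i. i < m \<and> i mod n = c} \<le> card {i. i < Suc q * n \<and> i mod n = c}"
      using assms by (intro card_mono) auto
    ultimately have "q \<le> card {i. i < m \<and> i mod n = c}" "card {i. i < m \<and> i mod n = c} \<le> Suc q"
      by (simp_all only: card_mod_fibre[OF that])
    then have "card {i. i < m \<and> i mod n = c} = q \<or> card {i. i < m \<and> i mod n = c} = Suc q"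
      by linarith
    then show ?thesis
      by auto
  qed
  then have excess: "(\<Sum>c<n. (int (card {i. i < m \<and> i mod n = c}) - int q) *
      (int (card {i. i < m \<and> i mod n = c}) - int q - 1)) = 0"
    by (intro sum.neutral) blast
  have "(\<lambda>i. i mod n) \<in> {..<m} \<rightarrow> {..<n}"
    using assms by auto
  then show ?thesis
    by (simp only: card_collisions_excess[where q = "int q"] excess add_0_right)
qed

section \<open>Strict separations and the final chain\<close>

theorem PHP_strictly_above_Suc:
  fixes m n q :: nat
  assumes "q \<ge> 1" "q * n \<le> m" "Suc m < Suc q * n"
  shows "PHP m n >\<^sub>P PHP (Suc m) n"
proof -
  have "\<not> PHP m n \<le>\<^sub>P PHP (Suc m) n"
  proof
    assume red: "PHP m n \<le>\<^sub>P PHP (Suc m) n"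
    have n: "n > 0"
      using assms(3) by (cases n) auto
    then have m: "m > 0"
      using assms(1,2) by (cases m) auto
    define g where "g i = i mod n" for i :: nat
    define K where "K = int n * (int q * (int q + 1))"
    have card_g: "int (card (collisions m g)) = 2 * int q * int m - K"
      using card_collisions_mod[of n q m] n assms by (simp add: g_def[abs_def] K_def)
    \<comment> \<open>The same \<open>q\<close> serves for \<open>m\<close> and \<open>Suc m\<close>
      pigeons, so both counts use the same line. The bound must be a natural number here; truncation
      by \<open>nat\<close> can only raise it, which is harmless when returning to integers
      below.\<close>
    have "nat (2 * int q * int (Suc m) - K) \<le> card (collisions (Suc m) h)"
      if "h \<in> {..<Suc m} \<rightarrow> {..<n}" for h
      using card_collisions_ge[OF that, of "int q"] unfolding K_def by linarith
    moreover have "g \<in> {..<m} \<rightarrow> {..<n}"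
      using n by (auto simp: g_def)
    ultimately have "nat (2 * int q * int (Suc m) - K) * (m * (m - 1))
      \<le> card (collisions m g) * (Suc m * (Suc m - 1))"
      by (intro PHP_reducible_imp_collision_density_le[OF red])
    then have "m * (nat (2 * int q * int (Suc m) - K) * (m - 1))
      \<le> m * (card (collisions m g) * Suc m)"
      by (simp only: diff_Suc_1 mult_ac)
    then have "nat (2 * int q * int (Suc m) - K) * (m - 1) \<le> card (collisions m g) * Suc m"
      using m by (metis nat_mult_le_cancel1)
    then have "int (nat (2 * int q * int (Suc m) - K) * (m - 1)) \<le> int (card (collisions m g) * Suc m)"
      by (rule of_nat_mono)
    moreover have "int (m - 1) = int m - 1" "int (Suc m) = int m + 1"
      using m by auto
    ultimately have "int (nat (2 * int q * int (Suc m) - K)) * (int m - 1)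
      \<le> int (card (collisions m g)) * (int m + 1)"
      by (simp only: of_nat_mult)
    moreover have "(2 * int q * int (Suc m) - K) * (int m - 1)
      \<le> int (nat (2 * int q * int (Suc m) - K)) * (int m - 1)"
      using m by (intro mult_right_mono) auto
    ultimately have "(2 * int q * (int m + 1) - K) * (int m - 1)
      \<le> (2 * int q * int m - K) * (int m + 1)"
      unfolding card_g by (simp add: add.commute)
    \<comment> \<open>After expansion the quadratic terms cancel, leaving
      \<open>K \<le> q * (m + 1)\<close>. Dividing by \<open>q\<close> contradicts the strict upper
      bound on \<open>Suc m\<close>.\<close>
    then have "int q * (int n * (int q + 1)) \<le> int q * (int m + 1)"
      by (simp add: K_def algebra_simps)
    then have "int n * (int q + 1) \<le> int m + 1"
      using assms(1) by simp
    then have "int (Suc q * n) \<le> int (Suc m)"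
      by (simp add: algebra_simps)
    then show False
      using assms(3) by linarith
  qed
  then show ?thesis
    by (simp add: strictly_above_def PHP_antimono)
qed

theorem theorem2p20:
  shows "id_problem 3 \<equiv>\<^sub>P PHP 3 2 \<and> PHP 3 2 \<equiv>\<^sub>P PHP 4 2 \<and> PHP 4 2 >\<^sub>P PHP 5 2 \<and>
    (\<forall>n::nat. n > 2 \<longrightarrow>
       id_problem ((n + 1) choose 2) \<equiv>\<^sub>P PHP (n + 1) n \<and>
       PHP (n + 1) n >\<^sub>P PHP (n + 2) n \<and>
       PHP (n + 2) n \<ge>\<^sub>P PHP (2 * n) n \<and>
       PHP (2 * n) n >\<^sub>P PHP (2 * n + 1) n \<and>
       PHP (2 * n + 1) n \<ge>\<^sub>P PHP (n ^ 2) n \<and>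
       PHP (n ^ 2) n >\<^sub>P PHP (n ^ 2 + 1) n)"
proof (intro conjI allI impI)
  show id3: "id_problem 3 \<equiv>\<^sub>P PHP 3 2"
    using id_problem_equiv_PHP_Suc[of 2] by (simp add: choose_two)
  show "PHP 3 2 \<equiv>\<^sub>P PHP 4 2"
    \<comment> \<open>The nontrivial direction passes through \<open>id_problem 3\<close>, which
      reduces to \<open>PHP 4 2\<close>.\<close>
    using id3 reducible_trans[OF _ id_problem_3_le_PHP_4_2] PHP_antimono[of 3 4 2]
    by (auto simp: problem_equiv_def)
  show "PHP 4 2 >\<^sub>P PHP 5 2"
    using PHP_strictly_above_Suc[of 2 2 4] by simp
  fix n :: nat
  assume n: "n > 2"
  show "id_problem ((n + 1) choose 2) \<equiv>\<^sub>P PHP (n + 1) n"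
    using id_problem_equiv_PHP_Suc[of n] by simp
  \<comment> \<open>The three separations take \<open>q\<close> to be 1, 2 and \<open>n\<close>. The
    strict bounds needed are \<open>n + 2 < 2 * n\<close>, \<open>2 * n + 1 < 3 * n\<close> and
    \<open>n ^ 2 + 1 < (n + 1) * n\<close>.\<close>
  show "PHP (n + 1) n >\<^sub>P PHP (n + 2) n"
    using PHP_strictly_above_Suc[of 1 n "n + 1"] n by simp
  show "PHP (n + 2) n \<ge>\<^sub>P PHP (2 * n) n"
    using n by (intro PHP_antimono) simp
  show "PHP (2 * n) n >\<^sub>P PHP (2 * n + 1) n"
    using PHP_strictly_above_Suc[of 2 n "2 * n"] n by simp
  have "3 * n \<le> n ^ 2"
    using n by (simp add: power2_eq_square)
  then show "PHP (2 * n + 1) n \<ge>\<^sub>P PHP (n ^ 2) n"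
    using n by (intro PHP_antimono) simp
  show "PHP (n ^ 2) n >\<^sub>P PHP (n ^ 2 + 1) n"
    using PHP_strictly_above_Suc[of n n "n ^ 2"] n by (simp add: power2_eq_square)
qed

end
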